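(* Let $k\in\mathbb N_+$, let $I=[x_{j-\frac12},x_{j+\frac12}]$ be a closed interval of positive length, and put $L=\lceil \frac{k+3}{2}\rceil$. Consider the optimization problem (A): maximize $\min\{\omega^-,\omega^+\}$ over $(\omega^-,\omega^+)\in\mathbb R^2$ subject to $$\langle p\rangle_I-\omega^-p(x_{j-\frac12})-\omega^+p(x_{j+\frac12})\ge 0\qquad\text{for all } p\in\mathbb P^k_+(I).$$ Then: (1) problem (A) has a unique optimal solution. (2) The boundary weights $(\omega^-_\star,\omega^+_\star)$ of an optimal 1D cell average decomposition (1D OCAD) for $\mathbb P^k$ on $I$ are unique and given by $$\omega^-_\star=\omega^+_\star=\frac{1}{L(L-1)},$$ and this pair is also the optimal solution of problem (A). (3) Consequently the classic decomposition given by the $L$-point Gauss--Lobatto quadrature rule on $I$ is a 1D OCAD for $\mathbb P^k$.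
   Context: $\mathbb P^k$ is the space of real univariate polynomials of degree at most $k$; $\mathbb P^k_+(I)=\{p\in\mathbb P^k: p(x)\ge 0\ \forall x\in I\}$; $\langle p\rangle_I=\frac1{|I|}\int_I p(x)\,dx$. A 1D feasible cell average decomposition (CAD) for $\mathbb P^k$ on $I$ is an identity $$\langle p\rangle_I=\omega^-p(x_{j-\frac12})+\omega^+p(x_{j+\frac12})+\sum_{s=1}^S\omega_s\,p(x^{(s)})$$ ($S\ge 0$ finite) that holds for all $p\in\mathbb P^k$, with all weights $\omega^\pm,\omega_s$ positive (they sum to one) and all nodes $x^{(s)}\in I$. A 1D OCAD is a feasible CAD that maximizes $\min\{\omega^-,\omega^+\}$ among all feasible CADs for $\mathbb P^k$ on $I$. The $L$-point Gauss--Lobatto rule (weights normalized to sum to one) has the two endpoints of $I$ among its nodes, is exact for polynomials of degree up to $2L-3\ge k$, and its two endpoint weights equal $\frac1{L(L-1)}$. *)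

theory Defs
  imports "HOL-Analysis.Analysis" "HOL-Computational_Algebra.Polynomial"
begin

text \<open>The cell is \<open>I = {a..b}\<close> with \<open>a < b\<close>.\<close>

definition poly_space :: "nat \<Rightarrow> real poly set" where
  "poly_space k = {p. degree p \<le> k}"

definition nonneg_poly_space :: "nat \<Rightarrow> real \<Rightarrow> real \<Rightarrow> real poly set" where
  "nonneg_poly_space k a b = {p \<in> poly_space k. \<forall>x\<in>{a..b}. poly p x \<ge> 0}"

definition cell_average :: "real \<Rightarrow> real \<Rightarrow> real poly \<Rightarrow> real" where
  "cell_average a b p = 1 / (b - a) * integral {a..b} (poly p)"

text \<open>
  \<open>left_weight\<close> and \<open>right_weight\<close> are the boundary weights \<open>\<omega>\<^sup>-\<close> and \<open>\<omega>\<^sup>+\<close>;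
  \<open>inner D\<close> lists the pairs (weight, node) of the remaining terms, so its length is the
  number \<open>S \<ge> 0\<close>. The inner nodes may be any points of the closed cell and need not be distinct.
\<close>
record cad =
  left_weight :: real
  right_weight :: real
  inner :: "(real \<times> real) list"

definition feasible_cad :: "nat \<Rightarrow> real \<Rightarrow> real \<Rightarrow> cad \<Rightarrow> bool" where
  "feasible_cad k a b D \<longleftrightarrow>
     left_weight D > 0 \<and> right_weight D > 0 \<and>
     (\<forall>(w, x)\<in>set (inner D). w > 0 \<and> x \<in> {a..b}) \<and>
     (\<forall>p\<in>poly_space k.
        cell_average a b p =
          left_weight D * poly p a + right_weight D * poly p b +
          (\<Sum>(w, x)\<leftarrow>inner D. w * poly p x))"

definition optimal_cad :: "nat \<Rightarrow> real \<Rightarrow> real \<Rightarrow> cad \<Rightarrow> bool" where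
  "optimal_cad k a b =
     is_arg_max (\<lambda>D. min (left_weight D) (right_weight D)) (feasible_cad k a b)"

text \<open>Problem (A); the pair is \<open>(\<omega>\<^sup>-, \<omega>\<^sup>+)\<close>, with no sign constraint imposed.\<close>

definition feasible_A :: "nat \<Rightarrow> real \<Rightarrow> real \<Rightarrow> real \<times> real \<Rightarrow> bool" where
  "feasible_A k a b = (\<lambda>(wm, wp).
     \<forall>p\<in>nonneg_poly_space k a b.
       cell_average a b p - wm * poly p a - wp * poly p b \<ge> 0)"

definition optimal_A :: "nat \<Rightarrow> real \<Rightarrow> real \<Rightarrow> real \<times> real \<Rightarrow> bool" where
  "optimal_A k a b = is_arg_max (\<lambda>(wm, wp). min wm wp) (feasible_A k a b)"

text \<open>
  The \<open>L\<close>-point Gauss--Lobatto rule on \<open>{a..b}\<close>, with nodes \<open>x 1 < \<dots> < x L\<close> and weights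
  \<open>w 1, \<dots>, w L\<close>. Exactness for constants forces the weights to sum to one. Positivity of the
  weights and the value of the endpoint weights are not part of the definition.
\<close>
definition gauss_lobatto ::
    "nat \<Rightarrow> real \<Rightarrow> real \<Rightarrow> (nat \<Rightarrow> real) \<Rightarrow> (nat \<Rightarrow> real) \<Rightarrow> bool" where
  "gauss_lobatto L a b x w \<longleftrightarrow>
     L \<ge> 2 \<and> strict_mono_on {1..L} x \<and> x 1 = a \<and> x L = b \<and>
     (\<forall>p\<in>poly_space (2 * L - 3). cell_average a b p = (\<Sum>i=1..L. w i * poly p (x i)))"

definition cad_of_rule :: "nat \<Rightarrow> (nat \<Rightarrow> real) \<Rightarrow> (nat \<Rightarrow> real) \<Rightarrow> cad" where
  "cad_of_rule L x w =
     \<lparr>left_weight = w 1, right_weight = w L, inner = map (\<lambda>i. (w i, x i)) [2..<L]\<rparr>"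

end

theory Submission
  imports Defs
begin

text \<open>
  With \<open>m = L - 1\<close>, let \<open>P\<close> be the \<open>m\<close>-th derivative of \<open>((x - a)(x - b))\<^sup>m\<close>, a multiple of the
  Legendre polynomial of the cell, and let \<open>q = P'\<close>, of degree \<open>L - 2\<close>. Integration by parts shows
  that \<open>(x - a)(x - b) q\<close> is orthogonal to all polynomials of degree at most \<open>L - 3\<close>. Therefore the
  inner nodes of every Gauss-Lobatto rule are the zeros of \<open>q\<close>, and exactness for \<open>(b - x) q\<close> and
  \<open>(x - a) q\<close> gives the endpoint weights. The inner weights are positive, so the rule is a feasible
  decomposition. Conversely, \<open>q\<^sup>2\<close> has degree \<open>2 L - 4 \<le> k\<close>, is nonnegative, vanishes at
  all inner nodes and takes equal values at the two endpoints; testing a pair feasible for (A) with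
  \<open>q\<^sup>2\<close> gives \<open>\<omega>\<^sup>- + \<omega>\<^sup>+ \<le> 2 / (L (L - 1))\<close>, and both optimality and uniqueness follow.
\<close>

section \<open>Cell averages of polynomials\<close>

lemma poly_integrable_on: "poly (p :: real poly) integrable_on {a..b}"
  by (intro integrable_continuous_interval continuous_intros)

lemma cell_average_add: "cell_average a b (p + q) = cell_average a b p + cell_average a b q"
  unfolding cell_average_def poly_add[abs_def]
  by (simp add: integral_add poly_integrable_on distrib_left)

lemma cell_average_smult: "cell_average a b (smult c p) = c * cell_average a b p"
  unfolding cell_average_def poly_smult[abs_def] by simp

lemma cell_average_0: "cell_average a b 0 = 0"
  using cell_average_smult[of a b 0 0] by simp

lemma cell_average_sum: "cell_average a b (sum f A) = (\<Sum>i\<in>A. cell_average a b (f i))"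
  by (induction A rule: infinite_finite_induct) (auto simp: cell_average_0 cell_average_add)

lemma cell_average_pderiv:
  assumes "a < b"
  shows "cell_average a b (pderiv p) = (poly p b - poly p a) / (b - a)"
proof -
  have "(poly (pderiv p) has_integral (poly p b - poly p a)) {a..b}"
    using assms
    by (intro fundamental_theorem_of_calculus)
      (auto intro: has_field_derivative_at_within[OF poly_DERIV]
        simp flip: has_real_derivative_iff_has_vector_derivative)
  then show ?thesis
    by (simp add: cell_average_def integral_unique)
qed

lemma cell_average_by_parts:
  assumes "a < b"
  shows "cell_average a b (pderiv p * q) =
    (poly p b * poly q b - poly p a * poly q a) / (b - a) - cell_average a b (p * pderiv q)"
  using cell_average_pderiv[OF assms, of "p * q"]
  by (simp add: pderiv_mult cell_average_add mult.commute)

text \<open>A continuous nonnegative function whose integral is zero vanishes on the whole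
  interval.\<close>

lemma cell_average_pos:
  assumes "a < b" and nonneg: "\<forall>x\<in>{a..b}. poly p x \<ge> 0" and "c \<in> {a..b}" and "poly p c > 0"
  shows "cell_average a b p > 0"
proof -
  have "integral {a..b} (poly p) \<ge> 0"
    using nonneg by (intro integral_nonneg poly_integrable_on) auto
  moreover have "integral {a..b} (poly p) \<noteq> 0"
    using integral_eq_0_iff[of a b "poly p"] assms continuous_on_poly[OF continuous_on_id, of "{a..b}" p]
    by force
  ultimately show ?thesis
    using \<open>a < b\<close> by (simp add: cell_average_def)
qed

text \<open>Repeated integration by parts moves the derivatives from \<open>F\<close> to
  \<open>g\<close>. The boundary terms vanish by the assumptions on \<open>F\<close>, and at most
  \<open>n\<close> differentiations annihilate \<open>g\<close>.\<close>

lemma cell_average_higher_pderiv_mult_eq_0: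
  assumes "a < b"
    and "\<And>j. j < n \<Longrightarrow> poly ((pderiv ^^ j) F) a = 0"
    and "\<And>j. j < n \<Longrightarrow> poly ((pderiv ^^ j) F) b = 0"
    and "degree g < n"
  shows "cell_average a b ((pderiv ^^ n) F * g) = 0"
  using assms(2-)
proof (induction n arbitrary: g)
  case (Suc n)
  have "cell_average a b ((pderiv ^^ Suc n) F * g) = - cell_average a b ((pderiv ^^ n) F * pderiv g)"
    using cell_average_by_parts[OF \<open>a < b\<close>, of "(pderiv ^^ n) F" g] Suc.prems by simp
  also have "\<dots> = 0"
  proof (cases "degree g = 0")
    case True
    then show ?thesis
      by (simp add: pderiv_eq_0_iff[THEN iffD2] cell_average_0)
  next
    case False
    then show ?thesis
      using Suc by (simp add: degree_pderiv)
  qed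
  finally show ?case .
qed simp

section \<open>The Legendre polynomial of the cell and its derivative\<close>

definition rodrigues :: "real \<Rightarrow> real \<Rightarrow> nat \<Rightarrow> real poly" where
  "rodrigues a b m = [:-a, 1:] ^ m * [:-b, 1:] ^ m"

text \<open>Rodrigues' formula without its normalizing factor: for \<open>a = -1\<close> and
  \<open>b = 1\<close> this is \<open>2 ^ m * fact m\<close> times the usual Legendre
  polynomial.\<close>

definition legendre :: "real \<Rightarrow> real \<Rightarrow> nat \<Rightarrow> real poly" where
  "legendre a b m = (pderiv ^^ m) (rodrigues a b m)"

definition lobatto :: "real \<Rightarrow> real \<Rightarrow> nat \<Rightarrow> real poly" where
  "lobatto a b m = pderiv (legendre a b m)"

text \<open>The symmetry in \<open>a\<close> and \<open>b\<close> lets every evaluation at the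
  endpoint \<open>a\<close> serve for \<open>b\<close> as well.\<close>

lemma rodrigues_commute: "rodrigues a b m = rodrigues b a m"
  by (simp add: rodrigues_def mult.commute)

lemma legendre_commute: "legendre a b m = legendre b a m"
  by (simp add: legendre_def rodrigues_commute[of a])

lemma lobatto_commute: "lobatto a b m = lobatto b a m"
  by (simp add: lobatto_def legendre_commute[of a])

lemma degree_lobatto: "degree (lobatto a b m) = m - 1"
  by (simp add: lobatto_def legendre_def rodrigues_def degree_pderiv degree_higher_pderiv
      degree_mult_eq degree_power_eq)

text \<open>Taylor's formula: the derivatives at \<open>c\<close> are read off from the coefficients
  of the shifted polynomial.\<close>

lemma poly_higher_pderiv_eq_coeff:
  "poly ((pderiv ^^ j) p) c = fact j * coeff (pcompose p [:c, 1:]) j" for p :: "real poly"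
proof -
  have "(pderiv ^^ j) (pcompose p [:c, 1:]) = pcompose ((pderiv ^^ j) p) [:c, 1:]"
    by (induction j) (simp_all add: pderiv_pcompose pderiv_pCons)
  then have "poly ((pderiv ^^ j) p) c = coeff ((pderiv ^^ j) (pcompose p [:c, 1:])) 0"
    by (simp add: poly_pcompose flip: poly_0_coeff_0)
  then show ?thesis
    by (simp add: coeff_higher_pderiv pochhammer_fact)
qed

text \<open>Shifting \<open>a\<close> to the origin exhibits the zero of order \<open>m\<close>
  there. The coefficients of index \<open>m\<close> and \<open>m + 1\<close> then yield the endpoint
  values of \<open>legendre\<close> and \<open>lobatto\<close>.\<close>

lemma rodrigues_pcompose:
  "pcompose (rodrigues a b m) [:a, 1:] = monom 1 m * [:a - b, 1:] ^ m"
proof -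
  have "pcompose (p ^ m) q = pcompose p q ^ m" for p q :: "real poly"
    by (induction m) (simp_all add: pcompose_mult pcompose_1)
  then show ?thesis
    by (simp add: rodrigues_def pcompose_mult pcompose_pCons monom_altdef)
qed

lemma poly_higher_pderiv_rodrigues_eq_0:
  assumes "j < m"
  shows "poly ((pderiv ^^ j) (rodrigues a b m)) a = 0"
    and "poly ((pderiv ^^ j) (rodrigues a b m)) b = 0"
proof -
  have *: "poly ((pderiv ^^ j) (rodrigues a b m)) a = 0" for a b
    using assms by (simp add: poly_higher_pderiv_eq_coeff rodrigues_pcompose coeff_monom_mult)
  show "poly ((pderiv ^^ j) (rodrigues a b m)) a = 0"
    by (rule *)
  show "poly ((pderiv ^^ j) (rodrigues a b m)) b = 0"
    unfolding rodrigues_commute[of a] by (rule *)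
qed

lemma poly_legendre_left: "poly (legendre a b m) a = fact m * (a - b) ^ m"
  by (simp add: legendre_def poly_higher_pderiv_eq_coeff rodrigues_pcompose coeff_monom_mult
      coeff_linear_poly_power)

lemma poly_lobatto_left:
  assumes "m \<ge> 1"
  shows "poly (lobatto a b m) a = fact (Suc m) * (real m * (a - b) ^ (m - 1))"
proof -
  have "lobatto a b m = (pderiv ^^ Suc m) (rodrigues a b m)"
    by (simp add: lobatto_def legendre_def)
  then show ?thesis
    using assms
    by (simp only: poly_higher_pderiv_eq_coeff rodrigues_pcompose coeff_monom_mult)
      (simp add: coeff_linear_poly_power)
qed

text \<open>The counterpart of the classical value \<open>m (m + 1) / 2\<close> of the derivative of
  the Legendre polynomial at 1. With \<open>m = L - 1\<close> it produces the denominator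
  \<open>L (L - 1)\<close> of the endpoint weights.\<close>

lemma poly_lobatto_left_legendre:
  assumes "m \<ge> 1"
  shows "(a - b) * poly (lobatto a b m) a = real m * (real m + 1) * poly (legendre a b m) a"
proof -
  obtain n where "m = Suc n"
    using assms by (cases m) auto
  then show ?thesis
    by (simp add: poly_lobatto_left poly_legendre_left)
qed

lemma poly_lobatto_right_sq:
  assumes "m \<ge> 1"
  shows "(poly (lobatto a b m) b)\<^sup>2 = (poly (lobatto a b m) a)\<^sup>2"
proof -
  have "((b - a) ^ n)\<^sup>2 = ((a - b) ^ n)\<^sup>2" for n
    by (metis power2_commute power_even_eq power_mult)
  \<comment> \<open>The first simplification swaps the endpoints to evaluate at \<open>b\<close>,
    the second swaps them back to evaluate at \<open>a\<close>.\<close>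
  then show ?thesis
    using assms
    by (simp add: lobatto_commute[of a b] poly_lobatto_left[of m b a] power_mult_distrib)
      (simp add: lobatto_commute[of b a] poly_lobatto_left[of m a b] power_mult_distrib)
qed

lemma poly_lobatto_left_ne_0:
  assumes "m \<ge> 1" and "a \<noteq> b"
  shows "poly (lobatto a b m) a \<noteq> 0"
  using assms by (simp add: poly_lobatto_left)

section \<open>Orthogonality relations\<close>

lemma cell_average_legendre_eq_0:
  assumes "a < b" and "degree g < m"
  shows "cell_average a b (legendre a b m * g) = 0"
  unfolding legendre_def using assms
  by (intro cell_average_higher_pderiv_mult_eq_0 poly_higher_pderiv_rodrigues_eq_0)

text \<open>One integration by parts moves the derivative onto \<open>(x - a)(x - b) g\<close>,
  which vanishes at both endpoints and whose derivative has degree below \<open>m\<close>. The case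
  \<open>g = 0\<close> is listed separately to cover \<open>m = 1\<close>, where no nonzero
  \<open>g\<close> qualifies.\<close>

lemma lobatto_orthogonal:
  assumes "a < b" and "g = 0 \<or> degree g + 2 \<le> m"
  shows "cell_average a b ([:-a, 1:] * [:-b, 1:] * lobatto a b m * g) = 0"
proof (cases "g = 0")
  case False
  define h where "h = [:-a, 1:] * [:-b, 1:] * g"
  have h: "poly h a = 0" "poly h b = 0"
    by (simp_all add: h_def del: mult_pCons_left mult_pCons_right)
  have "degree h = degree g + 2"
    using False by (simp add: h_def degree_mult_eq del: mult_pCons_left)
  then have "degree (pderiv h) < m"
    using assms False by (simp add: degree_pderiv)
  then have "cell_average a b (lobatto a b m * h) = 0"
    using cell_average_by_parts[OF \<open>a < b\<close>, of "legendre a b m" h] h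
      cell_average_legendre_eq_0[OF \<open>a < b\<close>, of "pderiv h" m]
    by (simp add: lobatto_def)
  then show ?thesis
    by (simp add: h_def mult_ac del: mult_pCons_left mult_pCons_right)
qed (simp add: cell_average_0)

text \<open>After integration by parts the remaining average of \<open>legendre\<close> is zero.
  Taking an endpoint for \<open>c\<close> leaves only the boundary term at the other
  endpoint.\<close>

lemma cell_average_linear_lobatto:
  assumes "a < b" and "m \<ge> 1"
  shows "cell_average a b ([:-c, 1:] * lobatto a b m) =
    (poly (legendre a b m) b * (b - c) - poly (legendre a b m) a * (a - c)) / (b - a)"
proof -
  have "pderiv [:-c, 1:] = 1"
    by (simp add: pderiv_pCons one_pCons)
  then show ?thesis
    using cell_average_by_parts[OF \<open>a < b\<close>, of "legendre a b m" "[:-c, 1:]"] \<open>m \<ge> 1\<close>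
      cell_average_legendre_eq_0[OF \<open>a < b\<close>, of 1 m]
    by (simp add: lobatto_def mult.commute[of "[:-c, 1:]"] del: mult_pCons_left mult_pCons_right)
qed

section \<open>Zeros of the derivative\<close>

text \<open>Rolle's theorem between neighbouring zeros. Adding the points in increasing order puts
  each new zero of the derivative to the right of \<open>Max A\<close>, hence apart from those found
  before.\<close>

lemma pderiv_roots_between:
  fixes p :: "real poly"
  assumes "finite S" and "S \<noteq> {}" and "\<forall>x\<in>S. poly p x = 0"
  shows "\<exists>T. finite T \<and> card T + 1 = card S \<and> T \<subseteq> {Min S<..<Max S} \<and>
    (\<forall>x\<in>T. poly (pderiv p) x = 0)"
  using assms
proof (induction S rule: finite_linorder_max_induct)
  case (insert c A)
  show ?case
  proof (cases "A = {}")
    case True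
    then show ?thesis
      by (intro exI[of _ "{}"]) auto
  next
    case False
    then obtain T where T: "finite T" "card T + 1 = card A" "T \<subseteq> {Min A<..<Max A}"
      "\<forall>x\<in>T. poly (pderiv p) x = 0"
      using insert by auto
    have M: "Max A \<in> A" "Min A \<in> A" "Max A < c" "Min A < c"
      using insert False by auto
    then have "poly p (Max A) = 0" "poly p c = 0"
      using insert.prems by auto
    with poly_MVT[OF \<open>Max A < c\<close>, of p] M obtain z
      where z: "Max A < z" "z < c" "poly (pderiv p) z = 0"
      by auto
    have "Min (insert c A) = Min A" "Max (insert c A) = c"
      using insert.hyps False M by (simp_all add: less_imp_le)
    moreover have "Min A < z"
      using Min_le[OF \<open>finite A\<close> \<open>Max A \<in> A\<close>] z by linarith
    moreover have "z \<notin> T" "c \<notin> A"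
      using T z insert.hyps by auto
    ultimately show ?thesis
      using T z M insert.hyps
      by (intro exI[of _ "insert z T"]) (auto intro: less_trans)
  qed
qed simp

text \<open>As long as \<open>j < m\<close>, the derivative of order \<open>j\<close> also vanishes
  at \<open>a\<close> and \<open>b\<close>. Its \<open>j\<close> inner zeros and these two give
  \<open>j + 1\<close> zeros of the next derivative by Rolle.\<close>

lemma higher_pderiv_rodrigues_roots:
  assumes "a < b" and "j \<le> m"
  shows "\<exists>S. finite S \<and> card S = j \<and> S \<subseteq> {a<..<b} \<and>
    (\<forall>x\<in>S. poly ((pderiv ^^ j) (rodrigues a b m)) x = 0)"
  using assms(2)
proof (induction j)
  case (Suc j)
  then obtain S where S: "finite S" "card S = j" "S \<subseteq> {a<..<b}"
    "\<forall>x\<in>S. poly ((pderiv ^^ j) (rodrigues a b m)) x = 0"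
    by auto
  define S' where "S' = insert a (insert b S)"
  have S': "finite S'" "S' \<noteq> {}" "card S' = j + 2"
    using S \<open>a < b\<close> by (auto simp: S'_def card_insert_if)
  have "S' \<subseteq> {a..b}" "a \<in> S'" "b \<in> S'"
    using S \<open>a < b\<close> by (auto simp: S'_def)
  then have "Min S' = a" "Max S' = b"
    using S' by (auto intro!: Min_eqI Max_eqI)
  moreover have "\<forall>x\<in>S'. poly ((pderiv ^^ j) (rodrigues a b m)) x = 0"
    using S Suc.prems by (auto simp: S'_def poly_higher_pderiv_rodrigues_eq_0)
  ultimately show ?case
    using pderiv_roots_between[OF S'(1,2), of "(pderiv ^^ j) (rodrigues a b m)"] S' by auto
qed auto

lemma lobatto_roots:
  assumes "a < b" and "m \<ge> 1"
  obtains S where "finite S" "card S = m - 1" "S \<subseteq> {a<..<b}" "\<forall>x\<in>S. poly (lobatto a b m) x = 0"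
proof -
  obtain S where S: "finite S" "card S = m" "S \<subseteq> {a<..<b}" "\<forall>x\<in>S. poly (legendre a b m) x = 0"
    using higher_pderiv_rodrigues_roots[OF \<open>a < b\<close> order_refl, of m] by (auto simp: legendre_def)
  then have "S \<noteq> {}"
    using \<open>m \<ge> 1\<close> by auto
  with S have "Min S \<in> {a<..<b}" "Max S \<in> {a<..<b}"
    by (meson Min_in Max_in subsetD)+
  moreover obtain T where "finite T" "card T + 1 = card S" "T \<subseteq> {Min S<..<Max S}"
    "\<forall>x\<in>T. poly (lobatto a b m) x = 0"
    using pderiv_roots_between[OF \<open>finite S\<close> \<open>S \<noteq> {}\<close>, of "legendre a b m"] S
    by (auto simp: lobatto_def)
  ultimately show thesis
    using S by (intro that[of T]) auto
qed

section \<open>Gauss-Lobatto rules\<close>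

lemma lagrange_basis:
  fixes A :: "real set"
  assumes "finite A" and "y \<in> A"
  obtains l where "degree l < card A" "\<And>z. z \<in> A \<Longrightarrow> poly l z = (if z = y then 1 else 0)"
proof
  define l where "l = smult (1 / (\<Prod>z\<in>A - {y}. y - z)) (\<Prod>z\<in>A - {y}. [:-z, 1:])"
  have "degree (\<Prod>z\<in>A - {y}. [:-z, 1:]) = card (A - {y})"
    by (subst degree_prod_sum_eq) auto
  moreover have "card (A - {y}) < card A"
    using assms by (intro psubset_card_mono) auto
  ultimately show "degree l < card A"
    by (simp add: l_def)
  show "poly l z = (if z = y then 1 else 0)" if "z \<in> A" for z
    using assms that by (auto simp: l_def poly_prod)
qed

text \<open>The weights are the averages of the Lagrange basis polynomials, since \<open>p\<close>
  equals its own interpolant.\<close>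

lemma interpolatory_rule_exists:
  assumes "finite A"
  obtains v where "\<And>p. degree p < card A \<Longrightarrow> cell_average a b p = (\<Sum>y\<in>A. v y * poly p y)"
proof -
  have "\<forall>y\<in>A. \<exists>l. degree l < card A \<and> (\<forall>z\<in>A. poly l z = (if z = y then 1 else 0))"
    using lagrange_basis[OF assms] by metis
  then obtain l where l: "\<And>y. y \<in> A \<Longrightarrow> degree (l y) < card A"
    "\<And>y z. y \<in> A \<Longrightarrow> z \<in> A \<Longrightarrow> poly (l y) z = (if z = y then 1 else 0)"
    by metis
  show thesis
  proof (rule that[of "\<lambda>y. cell_average a b (l y)"])
    fix p :: "real poly"
    assume p: "degree p < card A"
    define r where "r = (\<Sum>y\<in>A. smult (poly p y) (l y))"
    have "degree r < card A"
      unfolding r_def using l p by (intro degree_sum_less) (auto intro: le_less_trans[OF degree_smult_le])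
    moreover have "poly r z = poly p z" if "z \<in> A" for z
      using that l assms by (simp add: r_def poly_sum if_distrib[of "(*) _"] cong: if_cong)
    ultimately have "p = r"
      using p by (intro poly_eqI_degree[of A]) auto
    then have "cell_average a b p = cell_average a b r"
      by simp
    also have "\<dots> = (\<Sum>y\<in>A. cell_average a b (l y) * poly p y)"
      by (simp add: r_def cell_average_sum cell_average_smult mult.commute)
    finally show "cell_average a b p = (\<Sum>y\<in>A. cell_average a b (l y) * poly p y)" .
  qed
qed

text \<open>The interpolatory rule at the zeros of \<open>W\<close> is exact up to degree
  \<open>m\<close>. Division by \<open>W\<close> raises this to \<open>2 * m - 1\<close>, because
  the multiple of \<open>W\<close> has average zero by orthogonality.\<close>

lemma gauss_lobatto_exists:
  assumes "a < b" and "m \<ge> 1"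
  shows "\<exists>x w. gauss_lobatto (Suc m) a b x w"
proof -
  obtain S where S: "finite S" "card S = m - 1" "S \<subseteq> {a<..<b}"
    "\<forall>x\<in>S. poly (lobatto a b m) x = 0"
    using lobatto_roots[OF assms] .
  define A where "A = insert a (insert b S)"
  have A: "finite A" "card A = Suc m" "A \<subseteq> {a..b}" "a \<in> A" "b \<in> A"
    using S assms by (auto simp: A_def card_insert_if)
  define W where "W = [:-a, 1:] * [:-b, 1:] * lobatto a b m"
  have "lobatto a b m \<noteq> 0"
    using poly_lobatto_left_ne_0[of m a b] assms by auto
  then have W: "W \<noteq> 0" "degree W = Suc m"
    using assms by (auto simp: W_def degree_mult_eq degree_lobatto simp del: mult_pCons_left)
  have W0: "poly W z = 0" if "z \<in> A" for z
    using that S by (auto simp: W_def A_def simp del: mult_pCons_left mult_pCons_right)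
  obtain v where v: "\<And>p. degree p < card A \<Longrightarrow> cell_average a b p = (\<Sum>y\<in>A. v y * poly p y)"
    using interpolatory_rule_exists[OF A(1)] by metis
  have exact: "cell_average a b p = (\<Sum>y\<in>A. v y * poly p y)" if p: "degree p \<le> 2 * Suc m - 3" for p
  proof -
    define g r where "g = p div W" and "r = p mod W"
    have pgr: "p = W * g + r"
      by (simp add: g_def r_def)
    have r: "degree r < Suc m"
      using degree_mod_less[OF W(1), of p] W by (auto simp: r_def)
    \<comment> \<open>Here \<open>p\<close> has degree at most \<open>2 * m - 1\<close> and
      \<open>W\<close> has degree \<open>m + 1\<close>, so the quotient just meets the bound needed
      for orthogonality.\<close>
    have "degree g + 2 \<le> m" if "g \<noteq> 0"
    proof -
      have "degree (W * g) = Suc m + degree g"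
        using that W by (simp add: degree_mult_eq)
      then have "degree p = Suc m + degree g"
        using r pgr by (simp add: degree_add_eq_left)
      then show ?thesis
        using p assms by simp
    qed
    then have "cell_average a b (W * g) = 0"
      unfolding W_def using lobatto_orthogonal[OF \<open>a < b\<close>, of g m] by blast
    then have "cell_average a b p = cell_average a b r"
      by (simp add: pgr cell_average_add)
    \<comment> \<open>The remainder \<open>r\<close> has degree below the number of nodes and agrees
      with \<open>p\<close> at the nodes, where \<open>W\<close> vanishes.\<close>
    also have "\<dots> = (\<Sum>y\<in>A. v y * poly p y)"
      using v[of r] r A W0 by (simp add: pgr)
    finally show ?thesis .
  qed
  \<comment> \<open>Nodes are numbered from 1, list positions from 0.\<close>
  define x where "x i = sorted_list_of_set A ! (i - 1)" for i
  have mono: "strict_mono_on {1..Suc m} x"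
    using A by (auto simp: x_def strict_mono_on_def intro!: sorted_wrt_nth_less[of "(<)"])
  have img: "x ` {1..Suc m} = A"
  proof -
    have "{1..Suc m} = Suc ` {..<card A}"
      by (simp add: A lessThan_Suc_atMost image_Suc_atMost)
    then have "x ` {1..Suc m} = (\<lambda>i. sorted_list_of_set A ! i) ` {..<card A}"
      by (simp add: x_def image_image)
    also have "\<dots> = set (sorted_list_of_set A)"
      by (auto simp: set_conv_nth A)
    finally show ?thesis
      using A by simp
  qed
  have inj: "inj_on x {1..Suc m}"
    using mono by (rule strict_mono_on_imp_inj_on)
  have x1: "x 1 = a"
  proof -
    obtain i where i: "i \<in> {1..Suc m}" "x i = a"
      using img A by (metis imageE)
    have "x 1 \<in> A"
      using img by auto
    with i A show ?thesis
      using strict_mono_onD[OF mono, of 1 i] by (cases "i = 1") force+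
  qed
  have xL: "x (Suc m) = b"
  proof -
    obtain i where i: "i \<in> {1..Suc m}" "x i = b"
      using img A by (metis imageE)
    have "x (Suc m) \<in> A"
      using img by auto
    with i A show ?thesis
      using strict_mono_onD[OF mono, of i "Suc m"] by (cases "i = Suc m") force+
  qed
  have "gauss_lobatto (Suc m) a b x (\<lambda>i. v (x i))"
    unfolding gauss_lobatto_def poly_space_def
    using assms mono x1 xL exact sum.reindex[OF inj] by (auto simp: img[symmetric])
  then show ?thesis
    by blast
qed

section \<open>Nodes and weights of an arbitrary rule\<close>

lemma gauss_lobatto_isolate:
  assumes "gauss_lobatto L a b x w" and "degree p \<le> 2 * L - 3" and "i \<in> {1..L}"
    and "\<And>j. j \<in> {1..L} \<Longrightarrow> j \<noteq> i \<Longrightarrow> poly p (x j) = 0"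
  shows "cell_average a b p = w i * poly p (x i)"
proof -
  have "cell_average a b p = (\<Sum>j=1..L. w j * poly p (x j))"
    using assms by (auto simp: gauss_lobatto_def poly_space_def)
  also have "\<dots> = (\<Sum>j\<in>{i}. w j * poly p (x j))"
    using assms by (intro sum.mono_neutral_right) auto
  finally show ?thesis
    by simp
qed

lemma gauss_lobatto_inner_nodes:
  assumes "gauss_lobatto L a b x w" and "i \<in> {2..<L}"
  shows "a < x i" and "x i < b"
proof -
  have "strict_mono_on {1..L} x" "x 1 = a" "x L = b"
    using assms by (auto simp: gauss_lobatto_def)
  then show "a < x i" "x i < b"
    using assms(2) strict_mono_onD[of "{1..L}" x 1 i] strict_mono_onD[of "{1..L}" x i L] by auto
qed

text \<open>The product over the other inner nodes. Its degree \<open>L - 3\<close> keeps the two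
  test polynomials built from it, of degrees \<open>2 * L - 4\<close> and \<open>2 * L - 3\<close>,
  within the range of exactness.\<close>

lemma gauss_lobatto_node_poly:
  assumes gl: "gauss_lobatto L a b x w" and i: "i \<in> {2..<L}"
  obtains Q where "degree Q = L - 3" "poly Q (x i) \<noteq> 0"
    "\<And>j. j \<in> {2..<L} \<Longrightarrow> j \<noteq> i \<Longrightarrow> poly Q (x j) = 0"
proof
  define Q where "Q = (\<Prod>j\<in>{2..<L} - {i}. [:- x j, 1:])"
  have inj: "inj_on x {1..L}"
    using gl strict_mono_on_imp_inj_on unfolding gauss_lobatto_def by blast
  have "x i \<noteq> x j" if "j \<in> {2..<L} - {i}" for j
    using i that inj_onD[OF inj, of i j] by auto
  then show "poly Q (x i) \<noteq> 0"
    by (auto simp: Q_def poly_prod)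
  show "poly Q (x j) = 0" if "j \<in> {2..<L}" "j \<noteq> i" for j
    using that by (auto simp: Q_def poly_prod)
  have "degree Q = card ({2..<L} - {i})"
    unfolding Q_def by (subst degree_prod_sum_eq) auto
  then show "degree Q = L - 3"
    using i by simp
qed

text \<open>The test polynomial \<open>(x - a)(b - x) Q^2\<close> is nonnegative on the cell and
  vanishes at every node except \<open>x i\<close>, so its positive average has the sign of
  \<open>w i\<close>.\<close>

lemma gauss_lobatto_inner_weight_pos:
  assumes "a < b" and gl: "gauss_lobatto L a b x w" and i: "i \<in> {2..<L}"
  shows "w i > 0"
proof -
  obtain Q where Q: "degree Q = L - 3" "poly Q (x i) \<noteq> 0"
    "\<And>j. j \<in> {2..<L} \<Longrightarrow> j \<noteq> i \<Longrightarrow> poly Q (x j) = 0"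
    using gauss_lobatto_node_poly[OF gl i] by metis
  define p where "p = [:-a, 1:] * [:b, -1:] * Q ^ 2"
  have p_eq: "poly p y = (y - a) * (b - y) * (poly Q y)\<^sup>2" for y
    by (simp add: p_def algebra_simps)
  have nodes: "a < x i" "x i < b" "x 1 = a" "x L = b"
    using gauss_lobatto_inner_nodes[OF gl i] gl by (auto simp: gauss_lobatto_def)
  have pos: "poly p (x i) > 0"
    using nodes Q by (simp add: p_eq)
  have "Q \<noteq> 0"
    using Q by auto
  moreover have "L \<ge> 3"
    using i by simp
  ultimately have "degree p \<le> 2 * L - 3"
    using Q by (simp add: p_def degree_mult_eq degree_power_eq del: mult_pCons_left)
  moreover have "poly p (x j) = 0" if "j \<in> {1..L}" "j \<noteq> i" for j
    using that nodes Q(3)[of j] by (cases "j = 1 \<or> j = L") (auto simp: p_eq)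
  ultimately have "cell_average a b p = w i * poly p (x i)"
    using i by (intro gauss_lobatto_isolate[OF gl]) auto
  moreover have "cell_average a b p > 0"
    using nodes pos \<open>a < b\<close> by (intro cell_average_pos[of a b p "x i"]) (auto simp: p_eq)
  ultimately show ?thesis
    using pos by (simp add: zero_less_mult_iff)
qed

text \<open>The product of \<open>(x - a)(x - b)\<close>, \<open>lobatto\<close> and
  \<open>Q\<close> has average zero by orthogonality, while the rule reduces it to the single term
  at \<open>x i\<close>. There the weight and all factors other than \<open>lobatto\<close> are
  nonzero.\<close>

lemma gauss_lobatto_inner_node_root:
  assumes "a < b" and gl: "gauss_lobatto L a b x w" and i: "i \<in> {2..<L}"
  shows "poly (lobatto a b (L - 1)) (x i) = 0"
proof -
  obtain Q where Q: "degree Q = L - 3" "poly Q (x i) \<noteq> 0"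
    "\<And>j. j \<in> {2..<L} \<Longrightarrow> j \<noteq> i \<Longrightarrow> poly Q (x j) = 0"
    using gauss_lobatto_node_poly[OF gl i] by metis
  have "Q \<noteq> 0"
    using Q by auto
  define p where "p = [:-a, 1:] * [:-b, 1:] * lobatto a b (L - 1) * Q"
  have p_eq: "poly p y = (y - a) * (y - b) * poly (lobatto a b (L - 1)) y * poly Q y" for y
    by (simp add: p_def algebra_simps)
  have nodes: "a < x i" "x i < b" "x 1 = a" "x L = b"
    using gauss_lobatto_inner_nodes[OF gl i] gl by (auto simp: gauss_lobatto_def)
  have "lobatto a b (L - 1) \<noteq> 0"
    using poly_lobatto_left_ne_0[of "L - 1" a b] i \<open>a < b\<close> by fastforce
  moreover have "L \<ge> 3"
    using i by simp
  ultimately have "degree p \<le> 2 * L - 3"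
    using Q \<open>Q \<noteq> 0\<close> by (simp add: p_def degree_mult_eq degree_lobatto del: mult_pCons_left)
  moreover have "poly p (x j) = 0" if "j \<in> {1..L}" "j \<noteq> i" for j
    using that nodes Q(3)[of j] by (cases "j = 1 \<or> j = L") (auto simp: p_eq)
  ultimately have "cell_average a b p = w i * poly p (x i)"
    using i by (intro gauss_lobatto_isolate[OF gl]) auto
  moreover have "cell_average a b p = 0"
    unfolding p_def using Q i \<open>a < b\<close> by (intro lobatto_orthogonal) auto
  ultimately show ?thesis
    using Q nodes gauss_lobatto_inner_weight_pos[OF \<open>a < b\<close> gl i] by (auto simp: p_eq)
qed

text \<open>The polynomial \<open>(x - b) q\<close> vanishes at every node except \<open>a\<close>,
  and its average is the value of \<open>legendre\<close> at \<open>a\<close>. Comparing this with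
  \<open>(a - b) q(a)\<close> gives \<open>w 1 * m (m + 1) = 1\<close>; the right endpoint is
  symmetric.\<close>

lemma gauss_lobatto_endpoint_weights:
  assumes "a < b" and gl: "gauss_lobatto L a b x w"
  shows "w 1 = 1 / (real L * (real L - 1))" and "w L = 1 / (real L * (real L - 1))"
proof -
  define m where "m = L - 1"
  have L: "L \<ge> 2" "x 1 = a" "x L = b"
    using gl by (auto simp: gauss_lobatto_def)
  then have m: "m \<ge> 1" "real L = real m + 1"
    by (auto simp: m_def)
  have deg: "degree ([:-c, 1:] * lobatto a b m) \<le> 2 * L - 3" for c
    using degree_mult_le[of "[:-c, 1:]" "lobatto a b m"] L
    by (simp add: degree_lobatto m_def del: mult_pCons_left)
  have root: "poly (lobatto a b m) (x i) = 0" if "i \<in> {1..L}" "i \<noteq> 1" "i \<noteq> L" for i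
    using gauss_lobatto_inner_node_root[OF assms, of i] that by (auto simp: m_def)
  have ne: "poly (lobatto a b m) a \<noteq> 0" "poly (lobatto a b m) b \<noteq> 0"
    using poly_lobatto_left_ne_0[OF m(1), of a b] poly_lobatto_left_ne_0[OF m(1), of b a] \<open>a < b\<close>
    by (auto simp: lobatto_commute[of b a])
  have "cell_average a b ([:-b, 1:] * lobatto a b m) =
      w 1 * poly ([:-b, 1:] * lobatto a b m) (x 1)"
    using L root by (intro gauss_lobatto_isolate[OF gl deg]) (auto simp: algebra_simps)
  moreover have "cell_average a b ([:-b, 1:] * lobatto a b m) = poly (legendre a b m) a"
    using \<open>a < b\<close>
    by (subst cell_average_linear_lobatto[OF \<open>a < b\<close> m(1)]) (simp add: field_simps)
  ultimately have "poly (legendre a b m) a = w 1 * ((a - b) * poly (lobatto a b m) a)"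
    using L by (simp add: algebra_simps)
  then have "w 1 * (real m * (real m + 1)) * ((a - b) * poly (lobatto a b m) a) =
      1 * ((a - b) * poly (lobatto a b m) a)"
    using poly_lobatto_left_legendre[OF m(1), of a b] by simp
  then have "w 1 * (real m * (real m + 1)) = 1"
    using ne \<open>a < b\<close> by (simp only: mult_cancel_right) auto
  then show "w 1 = 1 / (real L * (real L - 1))"
    using m by (intro eq_divide_imp) (auto simp: mult.commute)
  have "cell_average a b ([:-a, 1:] * lobatto a b m) =
      w L * poly ([:-a, 1:] * lobatto a b m) (x L)"
    using L root by (intro gauss_lobatto_isolate[OF gl deg]) (auto simp: algebra_simps)
  moreover have "cell_average a b ([:-a, 1:] * lobatto a b m) = poly (legendre a b m) b"
    using \<open>a < b\<close>
    by (subst cell_average_linear_lobatto[OF \<open>a < b\<close> m(1)]) (simp add: field_simps)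
  ultimately have "poly (legendre a b m) b = w L * ((b - a) * poly (lobatto a b m) b)"
    using L by (simp add: algebra_simps)
  then have "w L * (real m * (real m + 1)) * ((b - a) * poly (lobatto a b m) b) =
      1 * ((b - a) * poly (lobatto a b m) b)"
    using poly_lobatto_left_legendre[OF m(1), of b a]
    by (simp add: legendre_commute[of b a] lobatto_commute[of b a] mult_ac)
  then have "w L * (real m * (real m + 1)) = 1"
    using ne \<open>a < b\<close> by (simp only: mult_cancel_right) auto
  then show "w L = 1 / (real L * (real L - 1))"
    using m by (intro eq_divide_imp) (auto simp: mult.commute)
qed

section \<open>Optimality\<close>

lemma feasible_cad_of_rule:
  assumes "a < b" and gl: "gauss_lobatto L a b x w" and "k \<le> 2 * L - 3"
  shows "feasible_cad k a b (cad_of_rule L x w)"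
proof -
  have L: "L \<ge> 2" "x 1 = a" "x L = b"
    using gl by (auto simp: gauss_lobatto_def)
  have "w 1 > 0" "w L > 0"
    using gauss_lobatto_endpoint_weights[OF \<open>a < b\<close> gl] L by simp_all
  moreover have "w i > 0" "x i \<in> {a..b}" if "i \<in> {2..<L}" for i
    using gauss_lobatto_inner_weight_pos[OF \<open>a < b\<close> gl that]
      gauss_lobatto_inner_nodes[OF gl that] by auto
  moreover have "cell_average a b p = w 1 * poly p a + w L * poly p b +
      (\<Sum>(v, y)\<leftarrow>map (\<lambda>i. (w i, x i)) [2..<L]. v * poly p y)" if "degree p \<le> k" for p
  proof -
    have "cell_average a b p = (\<Sum>i=1..L. w i * poly p (x i))"
      using gl that \<open>k \<le> 2 * L - 3\<close> by (auto simp: gauss_lobatto_def poly_space_def)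
    also have "{1..L} = insert 1 (insert L {2..<L})"
      using L by auto
    finally show ?thesis
      using L by (simp add: o_def interv_sum_list_conv_sum_set_nat)
  qed
  ultimately show ?thesis
    by (auto simp: feasible_cad_def cad_of_rule_def poly_space_def)
qed

text \<open>The inner terms contribute a nonnegative amount on nonnegative polynomials. Problem (A)
  is thus a relaxation of the search for an optimal decomposition, and its upper bounds carry
  over.\<close>

lemma feasible_A_of_cad:
  assumes "feasible_cad k a b D"
  shows "feasible_A k a b (left_weight D, right_weight D)"
proof -
  have "0 \<le> (\<Sum>(w, x)\<leftarrow>inner D. w * poly p x)" if "p \<in> nonneg_poly_space k a b" for p
    using assms that
    by (intro sum_list_nonneg) (fastforce simp: feasible_cad_def nonneg_poly_space_def)
  then show ?thesis
    using assms by (auto simp: feasible_A_def feasible_cad_def nonneg_poly_space_def)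
qed

text \<open>Any Gauss-Lobatto rule evaluates the average of \<open>q^2\<close> through the endpoints
  alone. As \<open>q^2\<close> takes one common nonzero value there, dividing by it leaves a bound
  on the sum \<open>u + v\<close>, whatever the signs of \<open>u\<close> and
  \<open>v\<close>.\<close>

lemma feasible_A_sum_le:
  assumes "a < b" and gl: "gauss_lobatto L a b x w" and k: "2 * L - 4 \<le> k"
    and feas: "feasible_A k a b (u, v)"
  shows "u + v \<le> 2 / (real L * (real L - 1))"
proof -
  define q where "q = lobatto a b (L - 1)"
  define c where "c = 1 / (real L * (real L - 1))"
  have L: "L \<ge> 2" "x 1 = a" "x L = b"
    using gl by (auto simp: gauss_lobatto_def)
  have qa: "poly q a \<noteq> 0" and qb: "(poly q b)\<^sup>2 = (poly q a)\<^sup>2"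
    using L \<open>a < b\<close> by (auto simp: q_def poly_lobatto_left_ne_0 poly_lobatto_right_sq)
  have "q \<noteq> 0"
    using qa by auto
  then have deg: "degree (q ^ 2) = 2 * L - 4"
    using L by (simp add: degree_power_eq q_def degree_lobatto)
  then have "q ^ 2 \<in> nonneg_poly_space k a b"
    using k by (simp add: nonneg_poly_space_def poly_space_def)
  then have "cell_average a b (q ^ 2) \<ge> u * (poly q a)\<^sup>2 + v * (poly q b)\<^sup>2"
    using feas by (auto simp: feasible_A_def)
  moreover have "cell_average a b (q ^ 2) = c * (poly q a)\<^sup>2 + c * (poly q b)\<^sup>2"
  proof -
    have "cell_average a b (q ^ 2) = (\<Sum>i=1..L. w i * poly (q ^ 2) (x i))"
      using gl deg by (auto simp: gauss_lobatto_def poly_space_def)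
    also have "\<dots> = (\<Sum>i\<in>{1, L}. w i * poly (q ^ 2) (x i))"
      using L gauss_lobatto_inner_node_root[OF \<open>a < b\<close> gl]
      by (intro sum.mono_neutral_right) (auto simp: q_def)
    finally show ?thesis
      using L gauss_lobatto_endpoint_weights[OF \<open>a < b\<close> gl] by (simp add: c_def)
  qed
  ultimately have "(u + v) * (poly q a)\<^sup>2 \<le> 2 * c * (poly q a)\<^sup>2"
    by (simp add: qb algebra_simps)
  then have "u + v \<le> 2 * c"
    using qa by (simp only: mult_le_cancel_right) auto
  then show ?thesis
    by (simp add: c_def)
qed

theorem theorem2p3:
  fixes k L :: nat and a b :: real
  assumes "k \<ge> 1" and "a < b" and "L = nat \<lceil>(real k + 3) / 2\<rceil>"
  shows "(\<exists>!\<omega>. optimal_A k a b \<omega>) \<and>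
    ((\<exists>D. optimal_cad k a b D) \<and>
     (\<forall>D. optimal_cad k a b D \<longrightarrow>
        left_weight D = 1 / (real L * (real L - 1)) \<and>
        right_weight D = 1 / (real L * (real L - 1))) \<and>
     optimal_A k a b (1 / (real L * (real L - 1)), 1 / (real L * (real L - 1)))) \<and>
    ((\<exists>x w. gauss_lobatto L a b x w) \<and>
     (\<forall>x w. gauss_lobatto L a b x w \<longrightarrow> optimal_cad k a b (cad_of_rule L x w)))"
proof -
  define c where "c = 1 / (real L * (real L - 1))"
  have "int L = \<lceil>(real k + 3) / 2\<rceil>"
    using assms(3) by simp
  then have "real_of_int \<lceil>(real k + 3) / 2\<rceil> = real L"
    by (metis of_int_of_nat_eq)
  from ceiling_correct[of "(real k + 3) / 2", unfolded this]
  have "2 * real L \<ge> real k + 3" "2 * real L < real k + 5"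
    by (simp_all add: field_simps)
  \<comment> \<open>The inequalities \<open>k + 3 <= 2 L < k + 5\<close> make the rule exact on the
    whole space and also place the square of degree \<open>2 * L - 4\<close> in that space.\<close>
  then have L: "L \<ge> 2" "k \<le> 2 * L - 3" "2 * L - 4 \<le> k"
    using assms(1) by linarith+
  have ex: "\<exists>x w. gauss_lobatto L a b x w"
    using gauss_lobatto_exists[OF \<open>a < b\<close>, of "L - 1"] L by simp
  then obtain x0 w0 where gl0: "gauss_lobatto L a b x0 w0"
    by blast
  have bound: "u + v \<le> 2 * c" if "feasible_A k a b (u, v)" for u v
    using feasible_A_sum_le[OF \<open>a < b\<close> gl0 L(3) that] by (simp add: c_def)
  have cad: "feasible_cad k a b (cad_of_rule L x w)"
    "left_weight (cad_of_rule L x w) = c" "right_weight (cad_of_rule L x w) = c"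
    if "gauss_lobatto L a b x w" for x w
    using feasible_cad_of_rule[OF \<open>a < b\<close> that L(2)]
      gauss_lobatto_endpoint_weights[OF \<open>a < b\<close> that] by (auto simp: c_def cad_of_rule_def)
  have feas: "feasible_A k a b (c, c)"
    using feasible_A_of_cad[OF cad(1)[OF gl0]] cad(2,3)[OF gl0] by simp
  \<comment> \<open>Both \<open>u\<close> and \<open>v\<close> are at least \<open>c\<close> for an
    optimal pair, and \<open>u + v <= 2 * c\<close> then forces equality; the same bound shows that
    no feasible pair beats \<open>(c, c)\<close>.\<close>
  have opt_A: "optimal_A k a b \<omega> \<longleftrightarrow> \<omega> = (c, c)" for \<omega>
  proof
    assume "optimal_A k a b \<omega>"
    moreover obtain u v where "\<omega> = (u, v)"
      by force
    ultimately have "feasible_A k a b (u, v)" "\<not> min u v < c"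
      using feas by (auto simp: optimal_A_def is_arg_max_def)
    with bound[of u v] \<open>\<omega> = (u, v)\<close> show "\<omega> = (c, c)"
      by (auto simp: min_def split: if_splits)
  next
    assume "\<omega> = (c, c)"
    then show "optimal_A k a b \<omega>"
      using feas bound by (fastforce simp: optimal_A_def is_arg_max_def min_def split: if_splits)
  qed
  have opt_rule: "optimal_cad k a b (cad_of_rule L x w)" if "gauss_lobatto L a b x w" for x w
  proof -
    have "\<not> c < min (left_weight D) (right_weight D)" if "feasible_cad k a b D" for D
      using bound[OF feasible_A_of_cad[OF that]] by linarith
    then show ?thesis
      using cad[OF that] by (auto simp: optimal_cad_def is_arg_max_def)
  qed
  \<comment> \<open>An optimal decomposition does at least as well as the Gauss-Lobatto one, so both
    weights are at least \<open>c\<close>; the bound inherited from (A) does the rest.\<close>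
  have weights: "left_weight D = c \<and> right_weight D = c" if "optimal_cad k a b D" for D
  proof -
    have D: "feasible_cad k a b D" "\<not> min (left_weight D) (right_weight D) < c"
      using that cad[OF gl0] by (force simp: optimal_cad_def is_arg_max_def)+
    then show ?thesis
      using bound[OF feasible_A_of_cad[OF D(1)]] by linarith
  qed
  show ?thesis
    unfolding c_def[symmetric]
  proof (intro conjI allI impI)
    show "\<exists>!\<omega>. optimal_A k a b \<omega>" "optimal_A k a b (c, c)"
      by (simp_all add: opt_A)
    show "\<exists>D. optimal_cad k a b D"
      using opt_rule[OF gl0] by blast
  qed (use weights opt_rule ex in simp_all)
qed

end
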